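(* Let $\mathcal{A}=(A,\alpha)$ be a monounary algebra without a cycle (i.e. without cyclic elements). If $\mathcal{A}$ is quasi-projective, then no connected component of $\mathcal{A}$ contains two different branches. The same conclusion holds if $\mathcal{A}$ is quasi-projective in the factor-algebra sense.
   Context: A monounary algebra is a pair $(A,\alpha)$ with $\alpha\colon A\to A$ a unary operation. A homomorphism $(A_1,\alpha_1)\to(A_2,\alpha_2)$ is a map $f\colon A_1\to A_2$ with $\alpha_2\circ f=f\circ\alpha_1$; an epimorphism is a surjective homomorphism; an endomorphism is a homomorphism from an algebra to itself. A subalgebra is a nonempty subset closed under $\alpha$, with the restricted operation. Quasi-projective: $\mathcal{A}$ is quasi-projective if for every monounary algebra $\mathcal{T}$, every homomorphism $f\colon\mathcal{A}\to\mathcal{T}$ and every epimorphism $j\colon\mathcal{A}\to\mathcal{T}$ there is an endomorphism $\phi$ of $\mathcal{A}$ with $j\circ\phi=f$ (first apply $\phi$, then $j$). Factor algebra: for a subalgebra $U$ of $\mathcal{A}$, let $\theta_U$ be the smallest congruence of $\mathcal{A}$ such that any two elements of $U$ lying in the same connected component of $\mathcal{A}$ are $\theta_U$-equivalent (equivalently, $(x,y)\in\theta_U$ iff $x=y$, or $x,y\in U$ lie in the same connected component of $\mathcal{A}$). Put $\mathcal{A}/U:=\mathcal{A}/\theta_U$ with operation $[x]\mapsto[\alpha(x)]$. $\mathcal{A}$ is quasi-projective in the factor-algebra sense if for every subalgebra $U$ of $\mathcal{A}$, every homomorphism $f\colon\mathcal{A}\to\mathcal{A}/U$ and every epimorphism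 $j\colon\mathcal{A}\to\mathcal{A}/U$ there is an endomorphism $\phi$ of $\mathcal{A}$ with $j\circ\phi=f$. Connected components are the classes of the equivalence relation $a\sim b$ iff $\alpha^k(a)=\alpha^l(b)$ for some $k,l\ge 0$. An element $a$ is cyclic if $\alpha^k(a)=a$ for some $k\ge 1$, otherwise acyclic. A branch is a maximal sequence $B=\{b_i\}_{i\in I}$ of acyclic elements with $b_i=\alpha(b_{i+1})$ whenever $i,i+1\in I$, where $I$ is one of $\{1,\dots,n\}$, $\mathbb{N}$, $\mathbb{Z}^-\cup\{0,1,\dots,n\}$, $\mathbb{Z}$; branches are regarded as sets of elements. *)

theory Defs
  imports "HOL-Library.FuncSet"
begin

definition monounary_algebra :: "'a set \<Rightarrow> ('a \<Rightarrow> 'a) \<Rightarrow> bool" where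
  "monounary_algebra A \<alpha> \<longleftrightarrow> \<alpha> \<in> A \<rightarrow> A"

(* Only the values on the carrier A matter: outside A all maps are arbitrary. *)
definition homomorphism ::
  "'a set \<Rightarrow> ('a \<Rightarrow> 'a) \<Rightarrow> 'b set \<Rightarrow> ('b \<Rightarrow> 'b) \<Rightarrow> ('a \<Rightarrow> 'b) \<Rightarrow> bool" where
  "homomorphism A \<alpha> B \<beta> f \<longleftrightarrow> f \<in> A \<rightarrow> B \<and> (\<forall>x\<in>A. \<beta> (f x) = f (\<alpha> x))"

definition epimorphism ::
  "'a set \<Rightarrow> ('a \<Rightarrow> 'a) \<Rightarrow> 'b set \<Rightarrow> ('b \<Rightarrow> 'b) \<Rightarrow> ('a \<Rightarrow> 'b) \<Rightarrow> bool" where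
  "epimorphism A \<alpha> B \<beta> f \<longleftrightarrow> homomorphism A \<alpha> B \<beta> f \<and> f ` A = B"

definition endomorphism :: "'a set \<Rightarrow> ('a \<Rightarrow> 'a) \<Rightarrow> ('a \<Rightarrow> 'a) \<Rightarrow> bool" where
  "endomorphism A \<alpha> \<phi> \<longleftrightarrow> homomorphism A \<alpha> A \<alpha> \<phi>"

definition subalgebra :: "'a set \<Rightarrow> 'a set \<Rightarrow> ('a \<Rightarrow> 'a) \<Rightarrow> bool" where
  "subalgebra U A \<alpha> \<longleftrightarrow> U \<subseteq> A \<and> U \<noteq> {} \<and> \<alpha> \<in> U \<rightarrow> U"

(* A definition cannot quantify over all types, so the test algebras T have their elements in
   'a set. This loses nothing: T is an epimorphic image of A, hence isomorphic to a quotient of A,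
   whose elements are subsets of A. Lemma quasi_projective_any_type below makes this precise. *)
definition quasi_projective :: "'a set \<Rightarrow> ('a \<Rightarrow> 'a) \<Rightarrow> bool" where
  "quasi_projective A \<alpha> \<longleftrightarrow>
    (\<forall>(T :: 'a set set) \<tau> f j.
       monounary_algebra T \<tau> \<longrightarrow> homomorphism A \<alpha> T \<tau> f \<longrightarrow> epimorphism A \<alpha> T \<tau> j \<longrightarrow>
       (\<exists>\<phi>. endomorphism A \<alpha> \<phi> \<and> (\<forall>x\<in>A. j (\<phi> x) = f x)))"

lemma quasi_projective_any_type:
  fixes A :: "'a set" and T :: "'t set"
  assumes "quasi_projective A \<alpha>" and T: "monounary_algebra T \<tau>"
    and f: "homomorphism A \<alpha> T \<tau> f" and j: "epimorphism A \<alpha> T \<tau> j"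
  shows "\<exists>\<phi>. endomorphism A \<alpha> \<phi> \<and> (\<forall>x\<in>A. j (\<phi> x) = f x)"
proof -
  define g where "g t = {x \<in> A. j x = t}" for t
  have inj: "inj_on g T"
    using j unfolding inj_on_def g_def epimorphism_def by blast
  define \<tau>' where "\<tau>' X = g (\<tau> (inv_into T g X))" for X
  have \<tau>': "\<tau>' (g t) = g (\<tau> t)" if "t \<in> T" for t
    using that inj by (simp add: \<tau>'_def)
  have "monounary_algebra (g ` T) \<tau>'"
    using T \<tau>' by (auto simp: monounary_algebra_def Pi_iff)
  moreover have "homomorphism A \<alpha> (g ` T) \<tau>' (g \<circ> f)"
    using f \<tau>' by (auto simp: homomorphism_def Pi_iff)
  moreover have "epimorphism A \<alpha> (g ` T) \<tau>' (g \<circ> j)"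
    using j \<tau>' by (auto simp: epimorphism_def homomorphism_def Pi_iff)
  ultimately obtain \<phi> where \<phi>: "endomorphism A \<alpha> \<phi>" "\<forall>x\<in>A. (g \<circ> j) (\<phi> x) = (g \<circ> f) x"
    using assms(1) unfolding quasi_projective_def by blast
  have "j (\<phi> x) = f x" if "x \<in> A" for x
  proof (rule inj_onD[OF inj])
    show "g (j (\<phi> x)) = g (f x)" using \<phi>(2) that by simp
    show "j (\<phi> x) \<in> T" "f x \<in> T"
      using \<phi>(1) f j that
      by (auto simp: endomorphism_def epimorphism_def homomorphism_def Pi_iff)
  qed
  with \<phi>(1) show ?thesis by blast
qed

definition connected_rel :: "'a set \<Rightarrow> ('a \<Rightarrow> 'a) \<Rightarrow> ('a \<times> 'a) set" where
  "connected_rel A \<alpha> = {(a, b). a \<in> A \<and> b \<in> A \<and> (\<exists>k l. (\<alpha> ^^ k) a = (\<alpha> ^^ l) b)}"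

definition components :: "'a set \<Rightarrow> ('a \<Rightarrow> 'a) \<Rightarrow> 'a set set" where
  "components A \<alpha> = A // connected_rel A \<alpha>"

definition congruence :: "'a set \<Rightarrow> ('a \<Rightarrow> 'a) \<Rightarrow> ('a \<times> 'a) set \<Rightarrow> bool" where
  "congruence A \<alpha> \<theta> \<longleftrightarrow> equiv A \<theta> \<and> (\<forall>(x, y)\<in>\<theta>. (\<alpha> x, \<alpha> y) \<in> \<theta>)"

definition factor_rel :: "'a set \<Rightarrow> ('a \<Rightarrow> 'a) \<Rightarrow> 'a set \<Rightarrow> ('a \<times> 'a) set" where
  "factor_rel A \<alpha> U =
    \<Inter> {\<theta>. congruence A \<alpha> \<theta> \<and> (\<forall>x\<in>U. \<forall>y\<in>U. (x, y) \<in> connected_rel A \<alpha> \<longrightarrow> (x, y) \<in> \<theta>)}"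

definition factor_carrier :: "'a set \<Rightarrow> ('a \<Rightarrow> 'a) \<Rightarrow> 'a set \<Rightarrow> 'a set set" where
  "factor_carrier A \<alpha> U = A // factor_rel A \<alpha> U"

(* The operation [x] |-> [\<alpha> x]; the union runs over equal classes (lemma factor_op_class). *)
definition factor_op :: "'a set \<Rightarrow> ('a \<Rightarrow> 'a) \<Rightarrow> 'a set \<Rightarrow> 'a set \<Rightarrow> 'a set" where
  "factor_op A \<alpha> U X = (\<Union>x\<in>X. factor_rel A \<alpha> U `` {\<alpha> x})"

lemma equiv_connected_rel:
  assumes "monounary_algebra A \<alpha>"
  shows "equiv A (connected_rel A \<alpha>)"
proof (rule equivI)
  show "connected_rel A \<alpha> \<subseteq> A \<times> A" by (auto simp: connected_rel_def)
  show "refl_on A (connected_rel A \<alpha>)"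
    by (auto simp: connected_rel_def refl_on_def)
  show "sym (connected_rel A \<alpha>)"
    unfolding connected_rel_def by (rule symI) (clarsimp, metis)
  show "trans (connected_rel A \<alpha>)"
  proof (rule transI)
    fix x y z
    assume "(x, y) \<in> connected_rel A \<alpha>" "(y, z) \<in> connected_rel A \<alpha>"
    then obtain k l m n where *: "x \<in> A" "z \<in> A" "(\<alpha> ^^ k) x = (\<alpha> ^^ l) y"
        "(\<alpha> ^^ m) y = (\<alpha> ^^ n) z"
      by (auto simp: connected_rel_def)
    have "(\<alpha> ^^ (m + k)) x = (\<alpha> ^^ (m + l)) y"
      using * by (simp add: funpow_add)
    also have "\<dots> = (\<alpha> ^^ (l + m)) y" by (simp add: add.commute)
    also have "\<dots> = (\<alpha> ^^ (l + n)) z"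
      using * by (simp add: funpow_add)
    finally show "(x, z) \<in> connected_rel A \<alpha>"
      using * by (auto simp: connected_rel_def)
  qed
qed

lemma connected_rel_step:
  assumes "monounary_algebra A \<alpha>" "(x, y) \<in> connected_rel A \<alpha>"
  shows "(\<alpha> x, \<alpha> y) \<in> connected_rel A \<alpha>"
proof -
  obtain k l where "x \<in> A" "y \<in> A" "(\<alpha> ^^ k) x = (\<alpha> ^^ l) y"
    using assms(2) by (auto simp: connected_rel_def)
  then have "\<alpha> x \<in> A" "\<alpha> y \<in> A" "(\<alpha> ^^ k) (\<alpha> x) = (\<alpha> ^^ l) (\<alpha> y)"
    using assms(1) funpow_swap1[of \<alpha> k x] funpow_swap1[of \<alpha> l y]
    by (auto simp: monounary_algebra_def Pi_iff)
  then show ?thesis by (auto simp: connected_rel_def)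
qed

lemma
  assumes A: "monounary_algebra A \<alpha>" and U: "subalgebra U A \<alpha>"
  shows factor_rel_eq: "factor_rel A \<alpha> U =
      {(x, y). x \<in> A \<and> y \<in> A \<and> (x = y \<or> x \<in> U \<and> y \<in> U \<and> (x, y) \<in> connected_rel A \<alpha>)}"
    and congruence_factor_rel: "congruence A \<alpha> (factor_rel A \<alpha> U)"
proof -
  let ?R = "{(x, y). x \<in> A \<and> y \<in> A \<and> (x = y \<or> x \<in> U \<and> y \<in> U \<and> (x, y) \<in> connected_rel A \<alpha>)}"
  have "sym (connected_rel A \<alpha>)" "trans (connected_rel A \<alpha>)"
    using equiv_connected_rel[OF A] by (auto simp: equiv_def)
  then have "sym ?R" "trans ?R"
    unfolding sym_def trans_def by blast+
  then have equ: "equiv A ?R"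
    by (intro equivI) (auto simp: refl_on_def)
  have step: "(\<alpha> x, \<alpha> y) \<in> ?R" if "(x, y) \<in> ?R" for x y
    using that A U connected_rel_step[OF A, of x y]
    by (auto simp: monounary_algebra_def subalgebra_def Pi_iff)
  have R: "congruence A \<alpha> ?R"
    unfolding congruence_def using equ step by fast
  show eq: "factor_rel A \<alpha> U = ?R"
  proof
    have "\<forall>x\<in>U. \<forall>y\<in>U. (x, y) \<in> connected_rel A \<alpha> \<longrightarrow> (x, y) \<in> ?R"
      using U by (auto simp: subalgebra_def)
    with R show "factor_rel A \<alpha> U \<subseteq> ?R"
      unfolding factor_rel_def by (intro Inter_lower CollectI conjI)
    show "?R \<subseteq> factor_rel A \<alpha> U"
      unfolding factor_rel_def
    proof (rule Inter_greatest)
      fix \<theta>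
      assume "\<theta> \<in> {\<theta>. congruence A \<alpha> \<theta> \<and>
        (\<forall>x\<in>U. \<forall>y\<in>U. (x, y) \<in> connected_rel A \<alpha> \<longrightarrow> (x, y) \<in> \<theta>)}"
      then have "refl_on A \<theta>" "\<forall>x\<in>U. \<forall>y\<in>U. (x, y) \<in> connected_rel A \<alpha> \<longrightarrow> (x, y) \<in> \<theta>"
        by (simp_all add: congruence_def equiv_def)
      then show "?R \<subseteq> \<theta>"
        by (auto dest: refl_onD)
    qed
  qed
  show "congruence A \<alpha> (factor_rel A \<alpha> U)"
    unfolding eq by (rule R)
qed

lemma factor_op_class:
  assumes A: "monounary_algebra A \<alpha>" and U: "subalgebra U A \<alpha>" and "x \<in> A"
  shows "factor_op A \<alpha> U (factor_rel A \<alpha> U `` {x}) = factor_rel A \<alpha> U `` {\<alpha> x}"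
proof -
  let ?R = "factor_rel A \<alpha> U"
  have e: "equiv A ?R" and c: "\<And>x y. (x, y) \<in> ?R \<Longrightarrow> (\<alpha> x, \<alpha> y) \<in> ?R"
    using congruence_factor_rel[OF A U] by (auto simp: congruence_def)
  have *: "?R `` {\<alpha> y} = ?R `` {\<alpha> x}" if "y \<in> ?R `` {x}" for y
    using equiv_class_eq[OF e c, of x y] that by simp
  have "x \<in> ?R `` {x}"
    using e \<open>x \<in> A\<close> by (rule equiv_class_self)
  with * show ?thesis
    unfolding factor_op_def by (intro UN_constant_eq ballI)
qed

definition factor_quasi_projective :: "'a set \<Rightarrow> ('a \<Rightarrow> 'a) \<Rightarrow> bool" where
  "factor_quasi_projective A \<alpha> \<longleftrightarrow>
    (\<forall>U f j. subalgebra U A \<alpha> \<longrightarrow>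
       homomorphism A \<alpha> (factor_carrier A \<alpha> U) (factor_op A \<alpha> U) f \<longrightarrow>
       epimorphism A \<alpha> (factor_carrier A \<alpha> U) (factor_op A \<alpha> U) j \<longrightarrow>
       (\<exists>\<phi>. endomorphism A \<alpha> \<phi> \<and> (\<forall>x\<in>A. j (\<phi> x) = f x)))"

definition cyclic_element :: "('a \<Rightarrow> 'a) \<Rightarrow> 'a \<Rightarrow> bool" where
  "cyclic_element \<alpha> a \<longleftrightarrow> (\<exists>k\<ge>1. (\<alpha> ^^ k) a = a)"

definition branch_index_set :: "int set \<Rightarrow> bool" where
  "branch_index_set I \<longleftrightarrow>
    (\<exists>n\<ge>1. I = {1..n}) \<or> I = {1..} \<or> (\<exists>n\<ge>0. I = {..<0} \<union> {0..n}) \<or> I = UNIV"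

definition branch_sequence :: "'a set \<Rightarrow> ('a \<Rightarrow> 'a) \<Rightarrow> int set \<Rightarrow> (int \<Rightarrow> 'a) \<Rightarrow> bool" where
  "branch_sequence A \<alpha> I b \<longleftrightarrow>
    branch_index_set I \<and>
    (\<forall>i\<in>I. b i \<in> A \<and> \<not> cyclic_element \<alpha> (b i)) \<and>
    (\<forall>i. i \<in> I \<and> i + 1 \<in> I \<longrightarrow> b i = \<alpha> (b (i + 1)))"

(* Since the elements are acyclic, such sequences are injective and are determined by their range
   up to an index shift; so a sequence cannot be extended at either end iff its range is
   inclusion-maximal among the ranges of such sequences. *)
definition branch :: "'a set \<Rightarrow> ('a \<Rightarrow> 'a) \<Rightarrow> 'a set \<Rightarrow> bool" where
  "branch A \<alpha> B \<longleftrightarrow>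
    (\<exists>I b. branch_sequence A \<alpha> I b \<and> B = b ` I \<and>
       (\<forall>J c. branch_sequence A \<alpha> J c \<and> b ` I \<subseteq> c ` J \<longrightarrow> c ` J = b ` I))"

end

theory Submission
  imports Defs
begin

text \<open>
  Two different branches in one component have to merge somewhere, so the theorem amounts to the
  injectivity of \<open>\<alpha>\<close>.

  Injectivity is forced by one lifting problem. Suppose that \<open>\<alpha> x = \<alpha> y = c\<close> with \<open>x \<noteq> y\<close>, and let
  \<open>U\<close> be the forward orbit of \<open>c\<close>. In \<open>\<A>/U\<close> this orbit becomes a fixed point \<open>u\<close>, and \<open>x\<close> and
  \<open>y\<close> sit directly above \<open>u\<close>. Take the projection for \<open>j\<close>, and for \<open>f\<close> the projection changed so
  that \<open>y\<close> and everything that flows into \<open>y\<close> collapses to \<open>u\<close>. A lift \<open>\<phi>\<close> must fix \<open>x\<close>, hence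
  also \<open>c\<close>, while \<open>\<phi> y\<close> lies in the orbit of \<open>c\<close>. But \<open>\<alpha> (\<phi> y) = \<phi> c = c\<close>, so \<open>c\<close> would be cyclic
  (\<open>factor_quasi_projective_imp_inj_on\<close>). Since \<open>\<A>/U\<close> is a monounary algebra, the same test
  algebra serves for quasi-projectivity proper (\<open>quasi_projective_imp_factor_quasi_projective\<close>).

  If \<open>\<alpha>\<close> is injective and has no cycles, a whole component is a chain and can be
  enumerated as a single branch sequence (\<open>component_is_branch_range\<close>). By maximality a branch
  contained in the component is then all of it.
\<close>

lemma funpow_closed:
  assumes "monounary_algebra A \<alpha>" "a \<in> A"
  shows "(\<alpha> ^^ n) a \<in> A"
  using assms by (induction n) (auto simp: monounary_algebra_def)

lemma funpow_inj_on:
  assumes "monounary_algebra A \<alpha>" "inj_on \<alpha> A"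
  shows "inj_on (\<alpha> ^^ n) A"
proof (induction n)
  case (Suc n)
  have "(\<alpha> ^^ n) ` A \<subseteq> A"
    using funpow_closed[OF assms(1)] by blast
  then have "inj_on \<alpha> ((\<alpha> ^^ n) ` A)"
    using assms(2) inj_on_subset by blast
  with Suc show ?case
    by (simp only: funpow.simps(2) comp_inj_on)
qed simp

lemma not_cyclic_funpow:
  assumes "\<not> cyclic_element \<alpha> a"
  shows "\<alpha> ((\<alpha> ^^ n) a) \<noteq> a"
proof
  assume "\<alpha> ((\<alpha> ^^ n) a) = a"
  then have "(\<alpha> ^^ Suc n) a = a" by simp
  with assms show False
    unfolding cyclic_element_def by (metis le_add1 plus_1_eq_Suc)
qed

lemma quasi_projective_imp_factor_quasi_projective:
  assumes A: "monounary_algebra A \<alpha>" and qp: "quasi_projective A \<alpha>"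
  shows "factor_quasi_projective A \<alpha>"
proof -
  have "monounary_algebra (factor_carrier A \<alpha> U) (factor_op A \<alpha> U)" if U: "subalgebra U A \<alpha>" for U
    unfolding monounary_algebra_def
  proof
    fix X assume "X \<in> factor_carrier A \<alpha> U"
    then obtain x where x: "x \<in> A" "X = factor_rel A \<alpha> U `` {x}"
      by (auto simp: factor_carrier_def elim: quotientE)
    have "\<alpha> x \<in> A"
      using A x(1) by (auto simp: monounary_algebra_def)
    then show "factor_op A \<alpha> U X \<in> factor_carrier A \<alpha> U"
      unfolding x(2) factor_op_class[OF A U x(1)] factor_carrier_def by (rule quotientI)
  qed
  with qp show ?thesis
    unfolding factor_quasi_projective_def quasi_projective_def by blast
qed

text \<open>
  Only the orbit of a merging point \<open>c = \<alpha> x = \<alpha> y\<close> is collapsed: this keeps \<open>x\<close> and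
  \<open>y\<close> apart in the factor algebra, but makes it possible to move \<open>y\<close> onto the fixed point without
  disturbing \<open>x\<close>.
\<close>
lemma factor_quasi_projective_imp_inj_on:
  assumes A: "monounary_algebra A \<alpha>"
    and acyclic: "\<forall>a\<in>A. \<not> cyclic_element \<alpha> a"
    and qp: "factor_quasi_projective A \<alpha>"
  shows "inj_on \<alpha> A"
proof (rule inj_onI, rule ccontr)
  fix x y assume x: "x \<in> A" and y: "y \<in> A" and xy: "\<alpha> x = \<alpha> y" "x \<noteq> y"
  have \<alpha>A: "\<alpha> z \<in> A" if "z \<in> A" for z
    using A that by (auto simp: monounary_algebra_def)
  define c where "c = \<alpha> y"
  define U where "U = range (\<lambda>n. (\<alpha> ^^ n) c)"
  define \<pi> where "\<pi> z = factor_rel A \<alpha> U `` {z}" for z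
  \<comment> \<open>\<open>D\<close> is closed under \<open>\<alpha>\<close> except at \<open>y\<close>, whose image \<open>c\<close> already represents the fixed
    point; so sending \<open>D\<close> to that point respects the operations.\<close>
  define D where "D = {z. \<exists>n. (\<alpha> ^^ n) z = y}"
  define f where "f z = (if z \<in> D then \<pi> c else \<pi> z)" for z
  have c: "c \<in> A" "\<alpha> x = c" "\<alpha> y = c"
    using y \<alpha>A xy by (auto simp: c_def)
  have no_return: "\<alpha> ((\<alpha> ^^ n) c) \<noteq> c" for n
    by (rule not_cyclic_funpow) (use acyclic c(1) in blast)
  have U_closed: "\<alpha> z \<in> U" if "z \<in> U" for z
  proof -
    obtain n where "z = (\<alpha> ^^ n) c"
      using \<open>z \<in> U\<close> unfolding U_def by blast
    then have "\<alpha> z = (\<alpha> ^^ Suc n) c" by simp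
    then show ?thesis unfolding U_def by (rule range_eqI)
  qed
  have cU: "c \<in> U"
    unfolding U_def by (rule range_eqI[of _ _ 0]) simp
  have U: "subalgebra U A \<alpha>"
    unfolding subalgebra_def using cU U_closed funpow_closed[OF A c(1)] by (auto simp: U_def)
  note rel = factor_rel_eq[OF A U]
  have equ: "equiv A (factor_rel A \<alpha> U)"
    using congruence_factor_rel[OF A U] by (simp add: congruence_def)
  have op_\<pi>: "factor_op A \<alpha> U (\<pi> z) = \<pi> (\<alpha> z)" if "z \<in> A" for z
    unfolding \<pi>_def by (rule factor_op_class[OF A U that])
  have \<pi>_c: "\<pi> (\<alpha> c) = \<pi> c"
  proof -
    have "(\<alpha> ^^ 1) c = (\<alpha> ^^ 0) (\<alpha> c)" by simp
    then have "(c, \<alpha> c) \<in> factor_rel A \<alpha> U"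
      unfolding rel connected_rel_def using c \<alpha>A[OF c(1)] cU U_closed[OF cU] by blast
    then show ?thesis
      unfolding \<pi>_def using equiv_class_eq[OF equ] by metis
  qed
  have D_step: "\<alpha> z \<in> D" if "z \<in> D" "z \<noteq> y" for z
  proof -
    obtain n where n: "(\<alpha> ^^ n) z = y" using \<open>z \<in> D\<close> by (auto simp: D_def)
    with \<open>z \<noteq> y\<close> obtain m where "n = Suc m" by (cases n) auto
    with n have "(\<alpha> ^^ m) (\<alpha> z) = y" by (simp add: funpow_swap1)
    then show ?thesis by (auto simp: D_def)
  qed
  have D_back: "z \<in> D" if "\<alpha> z \<in> D" for z
  proof -
    obtain n where "(\<alpha> ^^ n) (\<alpha> z) = y" using \<open>\<alpha> z \<in> D\<close> by (auto simp: D_def)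
    then have "(\<alpha> ^^ Suc n) z = y" by (simp add: funpow_swap1)
    then show ?thesis unfolding D_def by blast
  qed
  have fA: "f \<in> A \<rightarrow> factor_carrier A \<alpha> U"
    unfolding f_def \<pi>_def factor_carrier_def using c by (auto intro: quotientI)
  have "factor_op A \<alpha> U (f z) = f (\<alpha> z)" if "z \<in> A" for z
    using that op_\<pi> \<pi>_c D_step[of z] D_back[of z] c unfolding f_def by (cases "z = y") auto
  with fA have f: "homomorphism A \<alpha> (factor_carrier A \<alpha> U) (factor_op A \<alpha> U) f"
    by (simp add: homomorphism_def)
  have "\<pi> ` A = factor_carrier A \<alpha> U"
    unfolding \<pi>_def factor_carrier_def quotient_def by blast
  with op_\<pi> have j: "epimorphism A \<alpha> (factor_carrier A \<alpha> U) (factor_op A \<alpha> U) \<pi>"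
    by (auto simp: epimorphism_def homomorphism_def)
  obtain \<phi> where \<phi>: "endomorphism A \<alpha> \<phi>" and lift: "\<forall>z\<in>A. \<pi> (\<phi> z) = f z"
    using qp U f j unfolding factor_quasi_projective_def by blast
  have \<phi>A: "\<phi> z \<in> A" and \<phi>_step: "\<alpha> (\<phi> z) = \<phi> (\<alpha> z)" if "z \<in> A" for z
    using \<phi> that by (auto simp: endomorphism_def homomorphism_def)
  have same_class: "(a, b) \<in> factor_rel A \<alpha> U" if "\<pi> a = \<pi> b" "a \<in> A" "b \<in> A" for a b
    using that eq_equiv_class[OF _ equ] by (simp add: \<pi>_def)
  have xD: "x \<notin> D"
  proof
    assume "x \<in> D"
    then have "c \<in> D" using D_step xy c by metis
    then obtain n where "(\<alpha> ^^ n) c = y" by (auto simp: D_def)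
    with no_return[of n] c show False by simp
  qed
  have "x \<notin> U"
    unfolding U_def using no_return c by (metis rangeE)
  moreover have "(\<phi> x, x) \<in> factor_rel A \<alpha> U"
    using same_class lift \<phi>A x xD by (simp add: f_def)
  \<comment> \<open>The class of \<open>x\<close> is a singleton, so the lift has no choice at \<open>x\<close>.\<close>
  ultimately have "\<phi> x = x"
    unfolding rel by auto
  then have \<phi>c: "\<phi> c = c"
    using \<phi>_step[OF x] c by simp
  have "y \<in> D"
    unfolding D_def by (auto intro: exI[of _ 0])
  then have "(\<phi> y, c) \<in> factor_rel A \<alpha> U"
    using same_class lift \<phi>A y c by (simp add: f_def)
  then have "\<phi> y \<in> U"
    unfolding rel using cU by auto
  then obtain n where "\<phi> y = (\<alpha> ^^ n) c" by (auto simp: U_def)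
  then show False
    using \<phi>_step[OF y] \<phi>c c no_return[of n] by simp
qed

lemma connected_imp_comparable:
  assumes A: "monounary_algebra A \<alpha>" and inj: "inj_on \<alpha> A"
    and "(a, b) \<in> connected_rel A \<alpha>"
  shows "\<exists>n. b = (\<alpha> ^^ n) a \<or> a = (\<alpha> ^^ n) b"
proof -
  have cancel: "p = (\<alpha> ^^ (l - k)) q"
    if "p \<in> A" "q \<in> A" "(\<alpha> ^^ k) p = (\<alpha> ^^ l) q" "k \<le> l" for p q k l
  proof (rule inj_onD[OF funpow_inj_on[OF A inj, of k]])
    have "(\<alpha> ^^ l) q = (\<alpha> ^^ (k + (l - k))) q" using that by simp
    then show "(\<alpha> ^^ k) p = (\<alpha> ^^ k) ((\<alpha> ^^ (l - k)) q)"
      using that by (simp only: funpow_add comp_def)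
  qed (use that funpow_closed[OF A] in auto)
  obtain k l where kl: "a \<in> A" "b \<in> A" "(\<alpha> ^^ k) a = (\<alpha> ^^ l) b"
    using assms(3) by (auto simp: connected_rel_def)
  show ?thesis
    using cancel[of a b k l] cancel[of b a l k] kl by (metis nle_le)
qed

text \<open>
  A component of an injective algebra without cycles is either the orbit of its unique source,
  enumerated by the indices \<open>\<le> 0\<close>, or it has no source and is enumerated by all integers. In both
  cases index \<open>-n\<close> belongs to the \<open>n\<close>-th iterate of the element at index \<open>0\<close>, because
  branch sequences are indexed against the direction of \<open>\<alpha>\<close>.
\<close>
lemma component_is_branch_range:
  assumes A: "monounary_algebra A \<alpha>"
    and acyclic: "\<forall>a\<in>A. \<not> cyclic_element \<alpha> a"
    and inj: "inj_on \<alpha> A"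
    and C: "C \<in> components A \<alpha>"
  obtains I b where "branch_sequence A \<alpha> I b" "C \<subseteq> b ` I"
proof -
  obtain w where w: "w \<in> A" and Cw: "C = connected_rel A \<alpha> `` {w}"
    using C by (auto simp: components_def elim: quotientE)
  have equ: "equiv A (connected_rel A \<alpha>)"
    by (rule equiv_connected_rel[OF A])
  have CA: "C \<subseteq> A"
    unfolding Cw connected_rel_def by auto
  have "w \<in> C"
    unfolding Cw by (rule equiv_class_self[OF equ w])
  have comparable: "\<exists>n. p = (\<alpha> ^^ n) q \<or> q = (\<alpha> ^^ n) p" if "p \<in> C" "q \<in> C" for p q
  proof -
    have "(w, p) \<in> connected_rel A \<alpha>" "(w, q) \<in> connected_rel A \<alpha>"
      using that by (auto simp: Cw)
    then have "(q, p) \<in> connected_rel A \<alpha>"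
      using equ by (meson equiv_def symD transD)
    then show ?thesis
      by (rule connected_imp_comparable[OF A inj])
  qed
  show ?thesis
  proof (cases "C \<subseteq> \<alpha> ` A")
    case False
    then obtain s where s: "s \<in> C" "s \<notin> \<alpha> ` A" by blast
    define b where "b i = (\<alpha> ^^ nat (- i)) s" for i :: int
    have "s \<in> A" using s CA by blast
    have "branch_index_set ({..<0} \<union> {0..0})"
      unfolding branch_index_set_def by blast
    moreover have "b i = \<alpha> (b (i + 1))" if "i + 1 \<le> 0" for i
    proof -
      have "nat (- i) = Suc (nat (- (i + 1)))" using that by linarith
      then show ?thesis by (simp add: b_def)
    qed
    ultimately have "branch_sequence A \<alpha> ({..<0} \<union> {0..0}) b"
      unfolding branch_sequence_def using acyclic funpow_closed[OF A \<open>s \<in> A\<close>]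
      by (auto simp: b_def)
    moreover have "C \<subseteq> b ` ({..<0} \<union> {0..0})"
    proof
      fix z assume z: "z \<in> C"
      have "\<exists>n. z = (\<alpha> ^^ n) s"
      proof -
        obtain n where n: "z = (\<alpha> ^^ n) s \<or> s = (\<alpha> ^^ n) z"
          using comparable[OF z s(1)] by blast
        moreover have "s \<noteq> (\<alpha> ^^ Suc m) z" for m
          using s(2) funpow_closed[OF A, of z m] z CA by auto
        ultimately show ?thesis
          by (metis funpow_0 not0_implies_Suc)
      qed
      then obtain n where "z = (\<alpha> ^^ n) s" by blast
      then have "z = b (- int n)" by (simp add: b_def)
      moreover have "- int n \<in> {..<0} \<union> {0..0}" by auto
      ultimately show "z \<in> b ` ({..<0} \<union> {0..0})" by (rule image_eqI)
    qed
    ultimately show ?thesis by (rule that)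
  next
    case True
    have back_in_C: "z \<in> C" if "z \<in> A" "\<alpha> z \<in> C" for z
    proof -
      have "(w, \<alpha> z) \<in> connected_rel A \<alpha>"
        using that by (simp add: Cw)
      moreover have "(\<alpha> ^^ 0) (\<alpha> z) = (\<alpha> ^^ 1) z" by simp
      then have "(\<alpha> z, z) \<in> connected_rel A \<alpha>"
        unfolding connected_rel_def using that CA by blast
      ultimately show ?thesis
        using equ unfolding Cw by (meson Image_singleton_iff equiv_def transD)
    qed
    have predecessors: "\<exists>z\<in>C. (\<alpha> ^^ n) z = w" for n
    proof (induction n)
      case 0 then show ?case using \<open>w \<in> C\<close> by simp
    next
      case (Suc n)
      then obtain z where "z \<in> C" "(\<alpha> ^^ n) z = w" by blast
      moreover obtain z' where "z' \<in> A" "z = \<alpha> z'" using True \<open>z \<in> C\<close> by blast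
      ultimately show ?case
        using back_in_C[of z'] by (auto simp: funpow_swap1)
    qed
    define b where "b i = (if i \<le> 0 then (\<alpha> ^^ nat (- i)) w else inv_into A (\<alpha> ^^ nat i) w)"
      for i :: int
    have w_im: "w \<in> (\<alpha> ^^ n) ` A" for n
      using predecessors[of n] CA by blast
    have bA: "b i \<in> A" for i
      unfolding b_def using funpow_closed[OF A w] inv_into_into[OF w_im] by simp
    have b_pos: "(\<alpha> ^^ nat i) (b i) = w" if "0 \<le> i" for i
      using that f_inv_into_f[OF w_im] by (cases "i = 0") (auto simp: b_def)
    have b_eqI: "b i = z" if "0 \<le> i" "z \<in> A" "(\<alpha> ^^ nat i) z = w" for i z
      using inj_onD[OF funpow_inj_on[OF A inj, of "nat i"], of "b i" z] b_pos bA that by simp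
    have "b i = \<alpha> (b (i + 1))" for i
    proof (cases "0 \<le> i")
      case True
      then have "nat (i + 1) = Suc (nat i)" by linarith
      then have "(\<alpha> ^^ nat i) (\<alpha> (b (i + 1))) = w"
        using b_pos[of "i + 1"] True by (simp add: funpow_swap1)
      moreover have "\<alpha> (b (i + 1)) \<in> A"
        using A bA by (auto simp: monounary_algebra_def)
      ultimately show ?thesis using b_eqI True by blast
    next
      case False
      then have "nat (- i) = Suc (nat (- (i + 1)))" by linarith
      with False show ?thesis by (simp add: b_def)
    qed
    then have "branch_sequence A \<alpha> UNIV b"
      unfolding branch_sequence_def branch_index_set_def using acyclic bA by blast
    moreover have "C \<subseteq> range b"
    proof
      fix z assume z: "z \<in> C"
      obtain n where "z = (\<alpha> ^^ n) w \<or> w = (\<alpha> ^^ n) z"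
        using comparable[OF z \<open>w \<in> C\<close>] by blast
      then have "b (- int n) = z \<or> b (int n) = z"
        using b_eqI[of "int n" z] z CA by (auto simp: b_def)
      then show "z \<in> range b" by blast
    qed
    ultimately show ?thesis by (rule that)
  qed
qed

lemma branches_in_component_eq:
  assumes "monounary_algebra A \<alpha>" "\<forall>a\<in>A. \<not> cyclic_element \<alpha> a" "inj_on \<alpha> A"
    and "C \<in> components A \<alpha>"
    and "branch A \<alpha> B1" "branch A \<alpha> B2" "B1 \<subseteq> C" "B2 \<subseteq> C"
  shows "B1 = B2"
proof -
  obtain I b where b: "branch_sequence A \<alpha> I b" "C \<subseteq> b ` I"
    using component_is_branch_range[OF assms(1-4)] by blast
  have "B = b ` I" if "branch A \<alpha> B" "B \<subseteq> C" for B
  proof -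
    have "\<forall>J c. branch_sequence A \<alpha> J c \<and> B \<subseteq> c ` J \<longrightarrow> c ` J = B"
      using that(1) unfolding branch_def by blast
    with b that(2) show ?thesis by blast
  qed
  with assms show ?thesis by blast
qed

theorem lemma15:
  fixes A :: "'a set" and \<alpha> :: "'a \<Rightarrow> 'a"
  assumes "monounary_algebra A \<alpha>"
    and "\<forall>a\<in>A. \<not> cyclic_element \<alpha> a"
  shows "(quasi_projective A \<alpha> \<longrightarrow>
            (\<forall>C\<in>components A \<alpha>. \<not> (\<exists>B1 B2. branch A \<alpha> B1 \<and> branch A \<alpha> B2 \<and>
               B1 \<subseteq> C \<and> B2 \<subseteq> C \<and> B1 \<noteq> B2))) \<and>
         (factor_quasi_projective A \<alpha> \<longrightarrow>
            (\<forall>C\<in>components A \<alpha>. \<not> (\<exists>B1 B2. branch A \<alpha> B1 \<and> branch A \<alpha> B2 \<and>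
               B1 \<subseteq> C \<and> B2 \<subseteq> C \<and> B1 \<noteq> B2)))"
proof -
  have "B1 = B2"
    if "factor_quasi_projective A \<alpha>" "C \<in> components A \<alpha>" "branch A \<alpha> B1" "branch A \<alpha> B2"
      "B1 \<subseteq> C" "B2 \<subseteq> C" for C B1 B2
    using branches_in_component_eq[OF assms factor_quasi_projective_imp_inj_on[OF assms]] that
    by blast
  then show ?thesis
    using quasi_projective_imp_factor_quasi_projective[OF assms(1)] by blast
qed

end
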